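(* Let $n\ge2$, let $\mathscr{I}'=\{I'_1,\dots,I'_{m}\}$ be a partition of $\{1,\dots,n\}$ into nonempty consecutive blocks, and let $(\rho,V)$ be a nontrivial irreducible finite-dimensional representation of $\mathrm{SL}_n$ defined over $\mathbb{Q}$, with a norm $\|\cdot\|$ on $V(\mathbb{R})$. Let $V^{\mathrm{K}_{\mathscr{I}'}\mathrm{U}_{\mathscr{I}'}}$ be the subspace of vectors fixed by $\rho(\mathrm{K}_{\mathscr{I}'}\mathrm{U}_{\mathscr{I}'})$. Then there exists $C_2>0$ such that for all $v\in V^{\mathrm{K}_{\mathscr{I}'}\mathrm{U}_{\mathscr{I}'}}$ and all $d\in\mathrm{A}^+_{\mathrm{M}_{\mathscr{I}'}}$, $\|\rho(d)v\|\ge C_2\|v\|$.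
   Context: Consecutive blocks: $i_1<i_2$ whenever $i_1\in I'_{s}$, $i_2\in I'_t$, $s<t$. $\mathrm{U}_{\mathscr{I}'}:=\{g\in\mathrm{SL}_n(\mathbb{R}):(\mathrm{id}-g)\mathbb{R}^{I'_t}\subset\mathbb{R}^{I'_1\cup\dots\cup I'_{t-1}}\ \forall t\}$; $\mathrm{K}_{\mathscr{I}'}$ is the group of block-diagonal matrices (blocks indexed by the $I'_t$) each block lying in $\mathrm{SO}_{|I'_t|}(\mathbb{R})$. $\mathrm{A}^+_{\mathrm{M}_{\mathscr{I}'}}$ is the set of diagonal matrices $\mathrm{diag}(d_1,\dots,d_n)$ with positive entries, $\prod_{i\in I'_t}d_i=1$ for every $t$, and $d_{i+1}/d_i\ge1$ whenever $i,i+1$ lie in the same block. *)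

theory Defs
  imports "HOL-Analysis.Analysis"
begin

text \<open>Matrices in SL_n(R): index type 'n, finite and linearly ordered (a copy of {1..n}).\<close>
definition SL :: "(real^'n^'n) set" where
  "SL = {g. det g = 1}"

text \<open>Restriction to matrices of a polynomial in the n^2 matrix entries with rational coefficients.\<close>
definition rat_poly_fun :: "(real^'n^'n \<Rightarrow> real) \<Rightarrow> bool" where
  "rat_poly_fun f \<longleftrightarrow>
     (\<exists>(S :: ('n \<times> 'n \<Rightarrow> nat) set) (c :: ('n \<times> 'n \<Rightarrow> nat) \<Rightarrow> rat).
        finite S \<and>
        (\<forall>g. f g = (\<Sum>e\<in>S. of_rat (c e) * (\<Prod>p\<in>UNIV. (g $ fst p $ snd p) ^ e p))))"

text \<open>A finite-dimensional representation of SL_n defined over Q: V(R) = R^'m with its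
  standard Q-structure, rho a group homomorphism on SL_n(R) whose matrix coefficients are
  polynomials with rational coefficients in the matrix entries.\<close>
definition rat_rep :: "(real^'n^'n \<Rightarrow> real^'m^'m) \<Rightarrow> bool" where
  "rat_rep \<rho> \<longleftrightarrow>
     \<rho> (mat 1) = mat 1 \<and>
     (\<forall>g\<in>SL. \<forall>h\<in>SL. \<rho> (g ** h) = \<rho> g ** \<rho> h) \<and>
     (\<forall>a b. rat_poly_fun (\<lambda>g. \<rho> g $ a $ b))"

definition irreducible_rep :: "(real^'n^'n \<Rightarrow> real^'m^'m) \<Rightarrow> bool" where
  "irreducible_rep \<rho> \<longleftrightarrow>
     (\<forall>W. subspace W \<and> (\<forall>g\<in>SL. \<forall>w\<in>W. \<rho> g *v w \<in> W) \<longrightarrow> W = {0} \<or> W = UNIV)"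

definition nontrivial_rep :: "(real^'n^'n \<Rightarrow> real^'m^'m) \<Rightarrow> bool" where
  "nontrivial_rep \<rho> \<longleftrightarrow> (\<exists>g\<in>SL. \<rho> g \<noteq> mat 1)"

text \<open>An arbitrary norm on V(R).\<close>
definition is_norm :: "(real^'m \<Rightarrow> real) \<Rightarrow> bool" where
  "is_norm N \<longleftrightarrow> (\<forall>x y. N (x + y) \<le> N x + N y) \<and> (\<forall>c x. N (c *\<^sub>R x) = \<bar>c\<bar> * N x)
                 \<and> (\<forall>x. N x = 0 \<longrightarrow> x = 0)"

text \<open>Partition of the index set into nonempty consecutive blocks I'_1,...,I'_m (list entries).\<close>
definition consec_partition :: "'n::{finite,linorder} set list \<Rightarrow> bool" where
  "consec_partition Is \<longleftrightarrow>
     (\<forall>t<length Is. Is ! t \<noteq> {}) \<and> \<Union>(set Is) = UNIV \<and>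
     (\<forall>s t i1 i2. s < t \<and> t < length Is \<and> i1 \<in> Is ! s \<and> i2 \<in> Is ! t \<longrightarrow> i1 < i2)"

text \<open>R^I: vectors supported on I.\<close>
definition coord_sub :: "'n set \<Rightarrow> (real^'n) set" where
  "coord_sub I = {x. \<forall>i. i \<notin> I \<longrightarrow> x $ i = 0}"

definition U_grp :: "'n::{finite,linorder} set list \<Rightarrow> ((real,'n) vec,'n) vec set" where
  "U_grp Is = {g\<in>SL. \<forall>t<length Is. \<forall>x\<in>coord_sub (Is ! t).
       (mat 1 - g) *v x \<in> coord_sub (\<Union>{Is ! s | s. s < t})}"

text \<open>Determinant of the principal submatrix indexed by B (Leibniz formula).\<close>
definition det_block :: "real^'n^'n \<Rightarrow> 'n set \<Rightarrow> real" where
  "det_block g B = (\<Sum>p\<in>{p. p permutes B}. of_int (sign p) * (\<Prod>i\<in>B. g $ i $ p i))"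

definition K_grp :: "'n::{finite,linorder} set list \<Rightarrow> ((real,'n) vec,'n) vec set" where
  "K_grp Is = {g. (\<forall>i j. g $ i $ j \<noteq> 0 \<longrightarrow> (\<exists>t<length Is. i \<in> Is ! t \<and> j \<in> Is ! t))
      \<and> transpose g ** g = mat 1
      \<and> (\<forall>t<length Is. det_block g (Is ! t) = 1)}"

definition KU_grp :: "'n::{finite,linorder} set list \<Rightarrow> ((real,'n) vec,'n) vec set" where
  "KU_grp Is = {k ** u | k u. k \<in> K_grp Is \<and> u \<in> U_grp Is}"

definition A_plus :: "'n::{finite,linorder} set list \<Rightarrow> ((real,'n) vec,'n) vec set" where
  "A_plus Is = {d. \<exists>x :: 'n \<Rightarrow> real.
      d = (\<chi> i j. if i = j then x i else 0) \<and> (\<forall>i. x i > 0)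
      \<and> (\<forall>t<length Is. (\<Prod>i\<in>Is ! t. x i) = 1)
      \<and> (\<forall>i j. i < j \<and> \<not> (\<exists>k. i < k \<and> k < j) \<and> (\<exists>t<length Is. i \<in> Is ! t \<and> j \<in> Is ! t)
               \<longrightarrow> x j / x i \<ge> 1)}"

definition fixed_vecs :: "(real^'n^'n \<Rightarrow> real^'m^'m) \<Rightarrow> (real^'n^'n) set \<Rightarrow> (real^'m) set" where
  "fixed_vecs \<rho> H = {v. \<forall>h\<in>H. \<rho> h *v v = v}"

end

theory Submission
  imports Defs
begin

(* Write d = exp_diag h, where h sums to zero on every block. On the diagonal torus, rho is a finite
   sum of characters, rho (exp_diag h) = sum over L of exp (L h) P L, and linear independence of
   exponentials makes the P L torus-equivariant projections summing to the identity. Signed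
   transpositions inside a block lie in K, so on K-fixed vectors, rho (exp_diag (h o sigma)) for a
   block permutation sigma acts as rho (exp_diag h) followed by a fixed matrix. Averaged over the block
   permutations the orbit of h has barycentre 0, so for every weight L some sigma has L (h o sigma) >= 0,
   whence |P L v| <= |P L rho (exp_diag (h o sigma)) v| <= C |rho d v|. Summing over L gives
   |v| <= C' |rho d v|, and all norms on V(R) are equivalent. *)

section \<open>Diagonal and signed permutation matrices\<close>

definition exp_diag :: "('n::finite \<Rightarrow> real) \<Rightarrow> real^'n^'n" where
  "exp_diag h = (\<chi> i j. if i = j then exp (h i) else 0)"

lemma exp_diag_in_SL: "sum h UNIV = 0 \<Longrightarrow> exp_diag h \<in> SL"
  by (simp add: SL_def exp_diag_def det_diagonal exp_sum[symmetric])

lemma exp_diag_zero: "exp_diag (\<lambda>i. 0) = mat 1"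
  by (simp add: exp_diag_def mat_def vec_eq_iff)

lemma exp_diag_add: "exp_diag (\<lambda>i. h i + k i) = exp_diag h ** exp_diag k"
  by (simp add: exp_diag_def matrix_matrix_mult_def vec_eq_iff if_distrib[of "\<lambda>x. x * _"] exp_add cong: if_cong)

definition signed_perm_mat :: "('n::finite \<Rightarrow> 'n) \<Rightarrow> ('n \<Rightarrow> real) \<Rightarrow> real^'n^'n" where
  "signed_perm_mat \<tau> s = (\<chi> a c. if c = \<tau> a then s a else 0)"

lemma signed_perm_mat_orthogonal:
  assumes "bij \<tau>" "\<And>a. s a * s a = 1"
  shows "transpose (signed_perm_mat \<tau> s) ** signed_perm_mat \<tau> s = mat 1"
proof -
  have "(\<Sum>a\<in>UNIV. (if b = \<tau> a then s a else 0) * (if c = \<tau> a then s a else 0)) = (if b = c then 1 else 0)" for b c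
  proof -
    have "(\<Sum>a\<in>UNIV. (if b = \<tau> a then s a else 0) * (if c = \<tau> a then s a else 0))
        = (\<Sum>a\<in>UNIV. if a = inv \<tau> b then (if c = b then s a * s a else 0) else 0)"
      using assms(1) by (intro sum.cong) (auto simp: bij_inv_eq_iff)
    then show ?thesis using assms(2) by simp
  qed
  then show ?thesis by (simp add: matrix_matrix_mult_def signed_perm_mat_def transpose_def vec_eq_iff mat_def)
qed

lemma signed_perm_mat_conj_exp_diag:
  assumes "bij \<tau>" "\<And>a. s a * s a = 1"
  shows "signed_perm_mat \<tau> s ** exp_diag h ** transpose (signed_perm_mat \<tau> s) = exp_diag (h \<circ> \<tau>)"
proof -
  have inj: "\<tau> a = \<tau> b \<longleftrightarrow> a = b" for a b using assms(1) by (auto simp: bij_def inj_eq)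
  have "(signed_perm_mat \<tau> s ** exp_diag h) = (\<chi> a c. if c = \<tau> a then s a * exp (h c) else 0)"
    by (simp add: matrix_matrix_mult_def signed_perm_mat_def exp_diag_def vec_eq_iff if_distrib[of "\<lambda>x. x * _"] cong: if_cong)
  then show ?thesis
    using assms(2) by (simp add: matrix_matrix_mult_def signed_perm_mat_def exp_diag_def transpose_def vec_eq_iff inj
       if_distrib[of "\<lambda>x. x * _"] cong: if_cong)
qed

lemma det_block_monomial:
  assumes "\<sigma> permutes B" "\<And>a c. a \<in> B \<Longrightarrow> g $ a $ c \<noteq> 0 \<Longrightarrow> c = \<sigma> a"
  shows "det_block g B = of_int (sign \<sigma>) * (\<Prod>a\<in>B. g $ a $ \<sigma> a)"
proof -
  have "(\<Prod>a\<in>B. g $ a $ p a) = 0" if "p permutes B" "p \<noteq> \<sigma>" for p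
  proof -
    have "\<exists>a\<in>B. p a \<noteq> \<sigma> a"
    proof (rule ccontr)
      assume "\<not> ?thesis"
      then have "p x = \<sigma> x" for x
        using that(1) assms(1) by (cases "x \<in> B") (auto simp: permutes_not_in)
      then show False using that(2) by auto
    qed
    then show ?thesis using assms(2) by (intro prod_zero) auto
  qed
  then have "det_block g B =
      (\<Sum>p\<in>{p. p permutes B}. if p = \<sigma> then of_int (sign \<sigma>) * (\<Prod>a\<in>B. g $ a $ \<sigma> a) else 0)"
    unfolding det_block_def by (intro sum.cong) auto
  then show ?thesis using assms(1) by (simp add: finite_permutations)
qed

section \<open>Consecutive partitions\<close>

lemma consec_partition_block_unique:
  assumes "consec_partition Is" "s < length Is" "t < length Is" "i \<in> Is ! s" "i \<in> Is ! t"
  shows "s = t"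
  using assms unfolding consec_partition_def by (metis less_irrefl nat_neq_iff)

lemma consec_partition_covers:
  assumes "consec_partition Is"
  obtains t where "t < length Is" "i \<in> Is ! t"
proof -
  have "i \<in> \<Union>(set Is)" using assms by (simp add: consec_partition_def)
  then show thesis using that by (auto simp: in_set_conv_nth)
qed

lemma consec_partition_sum:
  assumes "consec_partition Is"
  shows "sum h UNIV = (\<Sum>t<length Is. sum h (Is ! t))"
proof -
  have cover: "(\<Union>t<length Is. Is ! t) = UNIV"
    using assms by (auto elim: consec_partition_covers)
  have "sum h (\<Union>t<length Is. Is ! t) = (\<Sum>t<length Is. sum h (Is ! t))"
    using consec_partition_block_unique[OF assms] by (intro sum.UNION_disjoint) auto
  then show ?thesis by (simp only: cover)
qed

definition same_block :: "'n set list \<Rightarrow> 'n \<Rightarrow> 'n \<Rightarrow> bool" where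
  "same_block Is i j \<longleftrightarrow> (\<exists>t<length Is. i \<in> Is ! t \<and> j \<in> Is ! t)"

lemma same_block_refl: "consec_partition Is \<Longrightarrow> same_block Is i i"
  unfolding same_block_def by (blast elim: consec_partition_covers)

lemma same_block_sym: "same_block Is i j \<Longrightarrow> same_block Is j i"
  unfolding same_block_def by blast

lemma same_block_trans:
  assumes "consec_partition Is" "same_block Is i j" "same_block Is j k"
  shows "same_block Is i k"
proof -
  obtain s t where "s < length Is" "i \<in> Is ! s" "j \<in> Is ! s" "t < length Is" "j \<in> Is ! t" "k \<in> Is ! t"
    using assms(2,3) by (auto simp: same_block_def)
  moreover from this have "s = t" using consec_partition_block_unique[OF assms(1)] by blast
  ultimately show ?thesis by (auto simp: same_block_def)
qed

section \<open>Signed transpositions in K\<close>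

text \<open>The sign at \<open>j\<close> makes every block determinant \<open>1\<close>, so that \<open>swap_mat i j\<close> lies in \<open>K\<close>.\<close>
definition swap_mat :: "'n::finite \<Rightarrow> 'n \<Rightarrow> real^'n^'n" where
  "swap_mat i j = signed_perm_mat (Transposition.transpose i j) (\<lambda>a. if a = j then -1 else 1)"

lemma transpose_swap_mat: "i \<noteq> j \<Longrightarrow> transpose (swap_mat i j) = swap_mat j i"
  by (simp add: swap_mat_def signed_perm_mat_def transpose_def vec_eq_iff Transposition.transpose_def)

lemma exp_diag_transpose_conj:
  assumes "i \<noteq> j"
  shows "exp_diag (h \<circ> Transposition.transpose i j) = swap_mat i j ** exp_diag h ** swap_mat j i"
proof -
  have "swap_mat i j ** exp_diag h ** transpose (swap_mat i j) = exp_diag (h \<circ> Transposition.transpose i j)"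
    unfolding swap_mat_def by (rule signed_perm_mat_conj_exp_diag) auto
  then show ?thesis using transpose_swap_mat[OF assms] by simp
qed

lemma det_block_swap_mat:
  assumes "i \<noteq> j" "i \<in> B \<longleftrightarrow> j \<in> B"
  shows "det_block (swap_mat i j) B = 1"
proof (cases "i \<in> B")
  case True
  have "det_block (swap_mat i j) B = - (\<Prod>a\<in>B. if a = j then -1 else 1)"
    using assms True
    by (subst det_block_monomial[where \<sigma> = "Transposition.transpose i j"])
       (auto simp: permutes_swap_id sign_swap_id swap_mat_def signed_perm_mat_def split: if_splits intro!: prod.cong)
  then show ?thesis using assms True by (simp add: prod.If_cases Int_absorb1)
next
  case False
  then show ?thesis using assms
    by (subst det_block_monomial[where \<sigma> = id])
       (auto simp: permutes_id sign_id swap_mat_def signed_perm_mat_def Transposition.transpose_def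
         split: if_splits intro!: prod.neutral)
qed

lemma swap_mat_in_SL: "i \<noteq> j \<Longrightarrow> swap_mat i j \<in> SL"
  using det_block_swap_mat[of i j UNIV] by (simp add: SL_def det_def det_block_def)

lemma swap_mat_in_K_grp:
  assumes cp: "consec_partition Is" and "i \<noteq> j" "same_block Is i j"
  shows "swap_mat i j \<in> K_grp Is"
  unfolding K_grp_def
proof (intro CollectI conjI allI impI)
  fix a c assume "swap_mat i j $ a $ c \<noteq> 0"
  then have "c = Transposition.transpose i j a"
    by (auto simp: swap_mat_def signed_perm_mat_def split: if_splits)
  then have "same_block Is a c"
    using assms by (auto simp: Transposition.transpose_def same_block_refl same_block_sym)
  then show "\<exists>t<length Is. a \<in> Is ! t \<and> c \<in> Is ! t" by (simp add: same_block_def)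
next
  show "transpose (swap_mat i j) ** swap_mat i j = mat 1"
    unfolding swap_mat_def by (rule signed_perm_mat_orthogonal) auto
next
  fix t assume "t < length Is"
  then have "i \<in> Is ! t \<longleftrightarrow> j \<in> Is ! t"
    using assms by (auto simp: same_block_def dest: consec_partition_block_unique)
  then show "det_block (swap_mat i j) (Is ! t) = 1" by (rule det_block_swap_mat[OF \<open>i \<noteq> j\<close>])
qed

lemma K_grp_subset_KU_grp: "K_grp Is \<subseteq> KU_grp Is"
proof
  fix k assume "k \<in> K_grp Is"
  moreover have "mat 1 \<in> U_grp Is" by (simp add: U_grp_def SL_def coord_sub_def)
  moreover have "k = k ** mat 1" by simp
  ultimately show "k \<in> KU_grp Is" unfolding KU_grp_def by blast
qed

lemma SL_mult: "g \<in> SL \<Longrightarrow> h \<in> SL \<Longrightarrow> g ** h \<in> SL"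
  by (simp add: SL_def det_mul)

lemma rat_rep_mult: "rat_rep \<rho> \<Longrightarrow> g \<in> SL \<Longrightarrow> h \<in> SL \<Longrightarrow> \<rho> (g ** h) = \<rho> g ** \<rho> h"
  unfolding rat_rep_def by blast

lemma exp_diag_transpose_on_fixed_vecs:
  assumes "rat_rep \<rho>" "consec_partition Is" "i \<noteq> j" "same_block Is i j"
    and "sum h UNIV = 0" "v \<in> fixed_vecs \<rho> (KU_grp Is)"
  shows "\<rho> (exp_diag (h \<circ> Transposition.transpose i j)) *v v = \<rho> (swap_mat i j) *v (\<rho> (exp_diag h) *v v)"
proof -
  have "swap_mat j i \<in> KU_grp Is"
    using swap_mat_in_K_grp[OF assms(2) _ same_block_sym[OF assms(4)]] assms(3) K_grp_subset_KU_grp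
    by blast
  then have "\<rho> (swap_mat j i) *v v = v" using assms(6) by (simp add: fixed_vecs_def)
  moreover have "\<rho> (exp_diag (h \<circ> Transposition.transpose i j))
      = \<rho> (swap_mat i j) ** \<rho> (exp_diag h) ** \<rho> (swap_mat j i)"
    using assms(3,5) by (simp add: exp_diag_transpose_conj rat_rep_mult[OF assms(1)] SL_mult swap_mat_in_SL exp_diag_in_SL)
  ultimately show ?thesis by (simp add: matrix_vector_mul_assoc[symmetric])
qed

section \<open>Block permutations\<close>

definition block_perms :: "'n::{finite,linorder} set list \<Rightarrow> ('n \<Rightarrow> 'n) set" where
  "block_perms Is = {\<sigma>. \<sigma> permutes UNIV \<and> (\<forall>i. same_block Is i (\<sigma> i))}"

lemma finite_block_perms: "finite (block_perms Is)"
  by (rule finite_subset[of _ "{p. p permutes UNIV}"]) (auto simp: block_perms_def finite_permutations)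

lemma id_in_block_perms: "consec_partition Is \<Longrightarrow> id \<in> block_perms Is"
  by (simp add: block_perms_def permutes_id same_block_refl)

lemma transpose_in_block_perms:
  "consec_partition Is \<Longrightarrow> same_block Is i j \<Longrightarrow> Transposition.transpose i j \<in> block_perms Is"
  by (auto simp: block_perms_def permutes_swap_id Transposition.transpose_def same_block_refl same_block_sym)

lemma block_perms_comp:
  "consec_partition Is \<Longrightarrow> \<sigma> \<in> block_perms Is \<Longrightarrow> \<tau> \<in> block_perms Is \<Longrightarrow> \<sigma> \<circ> \<tau> \<in> block_perms Is"
  unfolding block_perms_def by (auto intro: permutes_compose same_block_trans)

lemma block_perms_image:
  assumes "consec_partition Is" "\<sigma> \<in> block_perms Is" "t < length Is"
  shows "\<sigma> ` (Is ! t) = Is ! t"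
proof (rule endo_inj_surj)
  show "\<sigma> ` (Is ! t) \<subseteq> Is ! t"
    using assms by (auto simp: block_perms_def same_block_def dest: consec_partition_block_unique)
  from assms(2) have "inj \<sigma>" unfolding block_perms_def by (blast dest: permutes_inj)
  then show "inj_on \<sigma> (Is ! t)" by (rule inj_on_subset) simp
qed simp

lemma card_moved_transpose_comp_less:
  fixes \<sigma> :: "'a::finite \<Rightarrow> 'a"
  assumes "inj \<sigma>" "\<sigma> i \<noteq> i"
  shows "card {k. (Transposition.transpose i (\<sigma> i) \<circ> \<sigma>) k \<noteq> k} < card {k. \<sigma> k \<noteq> k}"
  using assms by (intro psubset_card_mono) (auto simp: Transposition.transpose_def inj_eq)

definition perm_realized_by ::
    "(((real,'n::{finite,linorder}) vec,'n) vec \<Rightarrow> real^'m^'m) \<Rightarrow> 'n set list \<Rightarrow>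
      ('n \<Rightarrow> 'n) \<Rightarrow> real^'m^'m \<Rightarrow> bool"
  where "perm_realized_by \<rho> Is \<sigma> M \<longleftrightarrow>
    (\<forall>(h :: 'n \<Rightarrow> real) v. sum h UNIV = 0 \<longrightarrow> v \<in> fixed_vecs \<rho> (KU_grp Is) \<longrightarrow>
       \<rho> (exp_diag (h \<circ> \<sigma>)) *v v = M *v (\<rho> (exp_diag h) *v v))"

lemma perm_realized_by_id: "perm_realized_by \<rho> Is id (mat 1)"
  by (simp add: perm_realized_by_def)

lemma perm_realized_by_transpose_comp:
  fixes \<rho> :: "((real,'n::{finite,linorder}) vec,'n) vec \<Rightarrow> real^'m^'m"
  assumes "rat_rep \<rho>" "consec_partition Is" "i \<noteq> j" "same_block Is i j"
    and realized: "perm_realized_by \<rho> Is \<tau> M"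
  shows "perm_realized_by \<rho> Is (Transposition.transpose i j \<circ> \<tau>) (M ** \<rho> (swap_mat i j))"
  unfolding perm_realized_by_def
proof (intro allI impI)
  fix h :: "'n \<Rightarrow> real" and v
  assume h: "sum h UNIV = 0" and v: "v \<in> fixed_vecs \<rho> (KU_grp Is)"
  let ?s = "Transposition.transpose i j"
  have "sum (h \<circ> ?s) UNIV = 0"
    using h sum.permute[where g = h, OF permutes_swap_id[of i UNIV j]] by simp
  then have "\<rho> (exp_diag ((h \<circ> ?s) \<circ> \<tau>)) *v v = M *v (\<rho> (exp_diag (h \<circ> ?s)) *v v)"
    using realized v by (simp add: perm_realized_by_def)
  also have "\<dots> = M *v (\<rho> (swap_mat i j) *v (\<rho> (exp_diag h) *v v))"
    using exp_diag_transpose_on_fixed_vecs[OF assms(1-4) h v] by simp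
  finally show "\<rho> (exp_diag (h \<circ> (?s \<circ> \<tau>))) *v v = (M ** \<rho> (swap_mat i j)) *v (\<rho> (exp_diag h) *v v)"
    by (simp add: comp_assoc matrix_vector_mul_assoc matrix_mul_assoc)
qed

lemma block_perms_realized:
  assumes rr: "rat_rep \<rho>" and cp: "consec_partition Is" and "\<sigma> \<in> block_perms Is"
  shows "\<exists>M. perm_realized_by \<rho> Is \<sigma> M"
  using assms(3)
proof (induction "card {i. \<sigma> i \<noteq> i}" arbitrary: \<sigma> rule: less_induct)
  case less
  show ?case
  proof (cases "\<sigma> = id")
    case True
    then show ?thesis using perm_realized_by_id by blast
  next
    case False
    then obtain i where i: "\<sigma> i \<noteq> i" by (metis eq_id_iff)
    let ?s = "Transposition.transpose i (\<sigma> i)"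
    have \<sigma>: "\<sigma> permutes UNIV" "same_block Is i (\<sigma> i)"
      using less.prems by (auto simp: block_perms_def)
    have "?s \<circ> \<sigma> \<in> block_perms Is"
      using cp \<sigma> less.prems by (intro block_perms_comp transpose_in_block_perms)
    moreover have "card {k. (?s \<circ> \<sigma>) k \<noteq> k} < card {k. \<sigma> k \<noteq> k}"
      using \<sigma>(1) i by (intro card_moved_transpose_comp_less) (auto simp: permutes_inj)
    ultimately obtain M where "perm_realized_by \<rho> Is (?s \<circ> \<sigma>) M"
      using less.hyps by blast
    then have "perm_realized_by \<rho> Is (?s \<circ> (?s \<circ> \<sigma>)) (M ** \<rho> (swap_mat i (\<sigma> i)))"
      using rr cp i \<sigma>(2) by (intro perm_realized_by_transpose_comp) auto
    then show ?thesis by (auto simp: comp_assoc[symmetric])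
  qed
qed

lemma block_perms_orbit_sum_eq:
  assumes cp: "consec_partition Is" and "same_block Is i j"
  shows "(\<Sum>\<sigma>\<in>block_perms Is. h (\<sigma> i)) = (\<Sum>\<sigma>\<in>block_perms Is. h (\<sigma> j))"
proof -
  let ?s = "Transposition.transpose i j"
  have closed: "\<sigma> \<circ> ?s \<in> block_perms Is" if "\<sigma> \<in> block_perms Is" for \<sigma>
    using assms that by (intro block_perms_comp transpose_in_block_perms)
  have "(\<Sum>\<sigma>\<in>block_perms Is. h (\<sigma> i)) = (\<Sum>\<sigma>\<in>block_perms Is. h ((\<sigma> \<circ> ?s) j))"
    by simp
  also have "\<dots> = (\<Sum>\<sigma>\<in>block_perms Is. h (\<sigma> j))"
    by (rule sum.reindex_bij_witness[where i = "\<lambda>\<sigma>. \<sigma> \<circ> ?s" and j = "\<lambda>\<sigma>. \<sigma> \<circ> ?s"])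
       (auto simp: closed comp_assoc Transposition.transpose_comp_involutory)
  finally show ?thesis .
qed

lemma block_perms_orbit_sum_zero:
  assumes cp: "consec_partition Is" and hb: "\<forall>t<length Is. sum h (Is ! t) = (0::real)"
  shows "(\<Sum>\<sigma>\<in>block_perms Is. h (\<sigma> i)) = 0"
proof -
  obtain t where t: "t < length Is" "i \<in> Is ! t" using consec_partition_covers[OF cp] by blast
  have "(\<Sum>j\<in>Is ! t. \<Sum>\<sigma>\<in>block_perms Is. h (\<sigma> j)) = (\<Sum>j\<in>Is ! t. \<Sum>\<sigma>\<in>block_perms Is. h (\<sigma> i))"
    using t by (intro sum.cong refl block_perms_orbit_sum_eq[OF cp]) (auto simp: same_block_def)
  also have "\<dots> = real (card (Is ! t)) * (\<Sum>\<sigma>\<in>block_perms Is. h (\<sigma> i))"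
    by simp
  finally have "real (card (Is ! t)) * (\<Sum>\<sigma>\<in>block_perms Is. h (\<sigma> i))
      = (\<Sum>\<sigma>\<in>block_perms Is. \<Sum>j\<in>Is ! t. h (\<sigma> j))"
    by (simp add: sum.swap[of _ "Is ! t"])
  also have "\<dots> = (\<Sum>\<sigma>\<in>block_perms Is. sum h (\<sigma> ` (Is ! t)))"
  proof (rule sum.cong[OF refl])
    fix \<sigma> assume "\<sigma> \<in> block_perms Is"
    then have "inj \<sigma>" unfolding block_perms_def by (blast dest: permutes_inj)
    then show "(\<Sum>j\<in>Is ! t. h (\<sigma> j)) = sum h (\<sigma> ` (Is ! t))"
      by (simp add: sum.reindex inj_on_subset)
  qed
  also have "\<dots> = 0"
    using cp t hb by (simp add: block_perms_image)
  finally show ?thesis using t by (auto simp: card_gt_0_iff)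
qed

text \<open>Averaging over the block permutations: the orbit of \<open>h\<close> has barycentre \<open>0\<close>.\<close>
lemma exists_block_perm_pairing_nonneg:
  assumes cp: "consec_partition Is" and hb: "\<forall>t<length Is. sum h (Is ! t) = (0::real)"
  shows "\<exists>\<sigma>\<in>block_perms Is. 0 \<le> (\<Sum>i\<in>UNIV. w i * h (\<sigma> i))"
proof (rule ccontr)
  assume "\<not> ?thesis"
  then have "(\<Sum>\<sigma>\<in>block_perms Is. \<Sum>i\<in>UNIV. w i * h (\<sigma> i)) < (\<Sum>\<sigma>\<in>block_perms Is. 0)"
    using cp finite_block_perms id_in_block_perms by (intro sum_strict_mono) (auto simp: not_le)
  moreover have "(\<Sum>\<sigma>\<in>block_perms Is. \<Sum>i\<in>UNIV. w i * h (\<sigma> i))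
      = (\<Sum>i\<in>UNIV. w i * (\<Sum>\<sigma>\<in>block_perms Is. h (\<sigma> i)))"
    by (simp add: sum.swap[of _ "block_perms Is"] sum_distrib_left)
  ultimately show False using block_perms_orbit_sum_zero[OF cp hb] by simp
qed

section \<open>Characters of the diagonal torus\<close>

lemma tendsto_exp_mult_neg_at_top:
  fixes a :: real
  assumes "a < 0"
  shows "((\<lambda>t. exp (t * a)) \<longlongrightarrow> 0) at_top"
proof -
  have "filterlim (\<lambda>t. t * a) at_bot at_top"
    using filterlim_tendsto_neg_mult_at_bot[OF tendsto_const assms filterlim_ident]
    by (simp add: mult.commute)
  then show ?thesis by (rule filterlim_compose[OF exp_at_bot])
qed

lemma exp_combination_dominant_coeff_eq_zero:
  fixes c :: "'a \<Rightarrow> 'b::real_normed_vector"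
  assumes A: "finite A" "m \<in> A" and less: "\<And>i. i \<in> A - {m} \<Longrightarrow> \<mu> i < \<mu> m"
    and zero: "\<And>t. (\<Sum>i\<in>A. exp (t * \<mu> i) *\<^sub>R c i) = 0"
  shows "c m = 0"
proof -
  text \<open>Dividing by the dominant exponential leaves \<open>c m\<close> plus a sum of decaying terms.\<close>
  have "c m = - (\<Sum>i\<in>A - {m}. exp (t * (\<mu> i - \<mu> m)) *\<^sub>R c i)" for t
  proof -
    have "exp (t * \<mu> m) *\<^sub>R (\<Sum>i\<in>A - {m}. exp (t * (\<mu> i - \<mu> m)) *\<^sub>R c i)
        = (\<Sum>i\<in>A - {m}. exp (t * \<mu> i) *\<^sub>R c i)"
      by (simp add: scaleR_sum_right right_diff_distrib exp_diff)
    then have "exp (t * \<mu> m) *\<^sub>R (c m + (\<Sum>i\<in>A - {m}. exp (t * (\<mu> i - \<mu> m)) *\<^sub>R c i)) = 0"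
      using zero[of t] sum.remove[OF A, of "\<lambda>i. exp (t * \<mu> i) *\<^sub>R c i"]
      by (simp add: scaleR_add_right)
    then show ?thesis by (simp add: eq_neg_iff_add_eq_0)
  qed
  moreover have "((\<lambda>t. \<Sum>i\<in>A - {m}. exp (t * (\<mu> i - \<mu> m)) *\<^sub>R c i) \<longlongrightarrow> 0) at_top"
  proof (rule tendsto_null_sum)
    fix i assume "i \<in> A - {m}"
    then have "\<mu> i - \<mu> m < 0" using less by simp
    from tendsto_scaleR[OF tendsto_exp_mult_neg_at_top[OF this] tendsto_const[of "c i"]]
    show "((\<lambda>t. exp (t * (\<mu> i - \<mu> m)) *\<^sub>R c i) \<longlongrightarrow> 0) at_top" by simp
  qed
  from tendsto_minus[OF this]
  have "((\<lambda>t. - (\<Sum>i\<in>A - {m}. exp (t * (\<mu> i - \<mu> m)) *\<^sub>R c i)) \<longlongrightarrow> 0) at_top"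
    by simp
  ultimately show ?thesis by (simp add: tendsto_const_iff)
qed

lemma exp_combination_eq_zero_imp_coeffs_zero:
  fixes c :: "'a \<Rightarrow> 'b::real_normed_vector"
  assumes "finite I" "inj_on \<mu> I" "\<And>t. (\<Sum>i\<in>I. exp (t * \<mu> i) *\<^sub>R c i) = 0" "i \<in> I"
  shows "c i = 0"
proof -
  have "inj_on \<mu> I \<longrightarrow> (\<forall>t. (\<Sum>i\<in>I. exp (t * \<mu> i) *\<^sub>R c i) = 0) \<longrightarrow> (\<forall>i\<in>I. c i = 0)"
    using assms(1)
  proof (induction rule: finite_remove_induct)
    case (remove A)
    show ?case
    proof (intro impI)
      assume inj: "inj_on \<mu> A" and zero: "\<forall>t. (\<Sum>i\<in>A. exp (t * \<mu> i) *\<^sub>R c i) = 0"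
      have "Max (\<mu> ` A) \<in> \<mu> ` A" using remove.hyps(1,2) by simp
      then obtain m where m: "m \<in> A" "\<mu> m = Max (\<mu> ` A)" by auto
      have "\<mu> i < \<mu> m" if "i \<in> A - {m}" for i
      proof -
        have "\<mu> i \<le> \<mu> m" using m that remove.hyps(1) by simp
        moreover have "\<mu> i \<noteq> \<mu> m" using inj m(1) that by (auto dest: inj_onD)
        ultimately show ?thesis by simp
      qed
      with zero have cm: "c m = 0"
        using exp_combination_dominant_coeff_eq_zero[OF remove.hyps(1) m(1)] by blast
      have "\<forall>t. (\<Sum>i\<in>A - {m}. exp (t * \<mu> i) *\<^sub>R c i) = 0"
        using zero cm by (simp add: sum.remove[OF remove.hyps(1) m(1)])
      then have "\<forall>i\<in>A - {m}. c i = 0"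
        using remove.IH[OF m(1)] inj_on_diff[OF inj] by blast
      then show "\<forall>i\<in>A. c i = 0" using cm by blast
    qed
  qed simp
  then show ?thesis using assms by blast
qed

text \<open>The junk value \<open>0\<close> off the trace-zero hyperplane makes two characters equal
  exactly when they agree on the Lie algebra of the diagonal torus of \<open>SL\<^sub>n\<close>.\<close>
definition torus_char :: "('n::finite \<Rightarrow> real) \<Rightarrow> ('n \<Rightarrow> real) \<Rightarrow> real" where
  "torus_char w h = (if sum h UNIV = 0 then (\<Sum>i\<in>UNIV. w i * h i) else 0)"

lemma torus_char_zero: "torus_char w (\<lambda>i. 0) = 0"
  by (simp add: torus_char_def)

lemma torus_char_add_scaled:
  assumes "sum h UNIV = 0" "sum k UNIV = 0"
  shows "torus_char w (\<lambda>i. h i + s * k i) = torus_char w h + s * torus_char w k"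
  using assms by (simp add: torus_char_def sum.distrib sum_distrib_left[symmetric] algebra_simps)

lemma torus_char_add:
  "sum h UNIV = 0 \<Longrightarrow> sum k UNIV = 0 \<Longrightarrow> torus_char w (\<lambda>i. h i + k i) = torus_char w h + torus_char w k"
  using torus_char_add_scaled[of h k w 1] by simp

lemma torus_char_scale: "sum h UNIV = 0 \<Longrightarrow> torus_char w (\<lambda>i. t * h i) = t * torus_char w h"
  using torus_char_add_scaled[of "\<lambda>i. 0" h w t] by (simp add: torus_char_zero)

lemma torus_char_diff: "torus_char w h - torus_char w' h = torus_char (\<lambda>i. w i - w' i) h"
  by (simp add: torus_char_def sum_subtractf algebra_simps)

lemma torus_chars_common_nonzero:
  assumes "finite P" "P \<subseteq> range torus_char" "(\<lambda>h. 0) \<notin> P"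
  shows "\<exists>h. sum h UNIV = 0 \<and> (\<forall>\<phi>\<in>P. \<phi> h \<noteq> 0)"
  using assms
proof (induction P rule: finite_induct)
  case empty
  show ?case by (intro exI[of _ "\<lambda>i. 0"]) simp
next
  case (insert \<phi> F)
  have "F \<subseteq> range torus_char" "(\<lambda>h. 0) \<notin> F" using insert.prems by auto
  from insert.IH[OF this] obtain h where h: "sum h UNIV = 0" "\<forall>\<psi>\<in>F. \<psi> h \<noteq> 0" by blast
  have char: "\<psi> \<in> range torus_char" if "\<psi> \<in> insert \<phi> F" for \<psi>
    using subsetD[OF insert.prems(1) that] .
  obtain g where g0: "\<phi> g \<noteq> 0" using insert.prems(2) by (auto simp: fun_eq_iff)
  from char[of \<phi>] obtain w where "\<phi> = torus_char w" by blast
  then have "sum g UNIV = 0" using g0 by (cases "sum g UNIV = 0") (simp_all add: torus_char_def)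
  note g = this g0
  have lin: "\<psi> (\<lambda>i. h i + s * g i) = \<psi> h + s * \<psi> g" if "\<psi> \<in> insert \<phi> F" for \<psi> s
    using char[OF that] torus_char_add_scaled[OF h(1) g(1)] by (elim rangeE) simp
  text \<open>Move from \<open>h\<close> along \<open>g\<close>, avoiding the finitely many parameters where some \<open>\<psi>\<close> vanishes.\<close>
  have "finite ((\<lambda>\<psi>. - \<psi> h / \<psi> g) ` insert \<phi> F)" using insert.hyps(1) by simp
  then obtain s :: real where s: "s \<notin> (\<lambda>\<psi>. - \<psi> h / \<psi> g) ` insert \<phi> F"
    using ex_new_if_finite[OF infinite_UNIV_char_0] by blast
  show ?case
  proof (intro exI conjI ballI)
    show "sum (\<lambda>i. h i + s * g i) UNIV = 0"
      using h(1) g(1) by (simp add: sum.distrib sum_distrib_left[symmetric])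
    fix \<psi> assume \<psi>: "\<psi> \<in> insert \<phi> F"
    show "\<psi> (\<lambda>i. h i + s * g i) \<noteq> 0"
    proof (cases "\<psi> g = 0")
      case True
      then show ?thesis using \<psi> lin[OF \<psi>] h(2) g(2) by auto
    next
      case False
      have "s \<noteq> - \<psi> h / \<psi> g" using s \<psi> by blast
      with False have "s * \<psi> g \<noteq> - \<psi> h" by (simp add: field_simps)
      then show ?thesis using lin[OF \<psi>, of s] by linarith
    qed
  qed
qed

lemma torus_chars_separating_point:
  assumes "finite E" "E \<subseteq> range torus_char"
  obtains h where "sum h UNIV = 0" "inj_on (\<lambda>L. L h) E"
proof -
  define P where "P = {\<lambda>h. L h - L' h | L L'. L \<in> E \<and> L' \<in> E} - {\<lambda>h. 0}"
  have "finite P"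
    unfolding P_def using assms(1) by (simp add: finite_image_set2)
  moreover have "(\<lambda>h. L h - L' h) \<in> range torus_char" if "L \<in> E" "L' \<in> E" for L L'
  proof -
    from subsetD[OF assms(2) that(1)] subsetD[OF assms(2) that(2)]
    obtain w w' where "L = torus_char w" "L' = torus_char w'" by (elim rangeE)
    then show ?thesis by (simp add: torus_char_diff)
  qed
  then have "P \<subseteq> range torus_char" unfolding P_def by blast
  moreover have "(\<lambda>h. 0) \<notin> P" unfolding P_def by blast
  ultimately have "\<exists>h. sum h UNIV = 0 \<and> (\<forall>\<phi>\<in>P. \<phi> h \<noteq> 0)"
    by (rule torus_chars_common_nonzero)
  then obtain h where h: "sum h UNIV = 0" "\<forall>\<phi>\<in>P. \<phi> h \<noteq> 0" by blast
  have "inj_on (\<lambda>L. L h) E"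
  proof (rule inj_onI, rule ccontr)
    fix L L' assume "L \<in> E" "L' \<in> E" "L h = L' h" "L \<noteq> L'"
    moreover from \<open>L \<noteq> L'\<close> have "(\<lambda>h. L h - L' h) \<noteq> (\<lambda>h. 0)" by (auto simp: fun_eq_iff)
    ultimately have "(\<lambda>h. L h - L' h) \<in> P" unfolding P_def by blast
    with h(2) \<open>L h = L' h\<close> show False by auto
  qed
  with h(1) that show thesis by blast
qed

lemma torus_chars_exp_independent:
  fixes c :: "_ \<Rightarrow> 'a::real_normed_vector"
  assumes "finite E" "E \<subseteq> range torus_char"
    and "\<And>h. sum h UNIV = 0 \<Longrightarrow> (\<Sum>L\<in>E. exp (L h) *\<^sub>R c L) = 0" "L \<in> E"
  shows "c L = 0"
proof -
  obtain h where h: "sum h UNIV = 0" "inj_on (\<lambda>L. L h) E"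
    using torus_chars_separating_point[OF assms(1,2)] by blast
  have scale: "L (\<lambda>i. t * h i) = t * L h" if "L \<in> E" for t L
    using that assms(2) h(1) by (auto simp: torus_char_scale)
  have "(\<Sum>L\<in>E. exp (t * L h) *\<^sub>R c L) = 0" for t
  proof -
    have "(\<Sum>L\<in>E. exp (t * L h) *\<^sub>R c L) = (\<Sum>L\<in>E. exp (L (\<lambda>i. t * h i)) *\<^sub>R c L)"
      using scale by (intro sum.cong) auto
    also have "\<dots> = 0"
      using h(1) by (intro assms(3)) (simp add: sum_distrib_left[symmetric])
    finally show ?thesis .
  qed
  then show ?thesis
    using exp_combination_eq_zero_imp_coeffs_zero[OF assms(1) h(2) _ assms(4)] by blast
qed

section \<open>Weight decomposition of the representation\<close>

lemma matrix_mult_sum_left: "(\<Sum>i\<in>I. A i) ** B = (\<Sum>i\<in>I. A i ** B)"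
  by (simp add: matrix_matrix_mult_def vec_eq_iff sum_component sum_distrib_right sum.swap[of _ I])

lemma matrix_vector_mult_sum_left: "(\<Sum>i\<in>I. A i) *v x = (\<Sum>i\<in>I. A i *v x)"
  by (simp add: matrix_vector_mult_def vec_eq_iff sum_component sum_distrib_right sum.swap[of _ I])

lemma prod_exp_diag_power:
  "(\<Prod>p\<in>UNIV. (exp_diag h $ fst p $ snd p) ^ e p) =
     (if \<forall>i j. i \<noteq> j \<longrightarrow> e (i, j) = 0 then exp (\<Sum>i\<in>UNIV. real (e (i, i)) * h i) else 0)"
proof -
  have "(\<Prod>p\<in>UNIV. (exp_diag h $ fst p $ snd p) ^ e p) = (\<Prod>i\<in>UNIV. \<Prod>j\<in>UNIV. (exp_diag h $ i $ j) ^ e (i, j))"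
    unfolding UNIV_Times_UNIV[symmetric] prod.cartesian_product by (simp add: case_prod_beta)
  also have "\<dots> = (if \<forall>i j. i \<noteq> j \<longrightarrow> e (i, j) = 0 then exp (\<Sum>i\<in>UNIV. real (e (i, i)) * h i) else 0)"
  proof (cases "\<forall>i j. i \<noteq> j \<longrightarrow> e (i, j) = 0")
    case True
    then have "(\<Prod>j\<in>UNIV. (exp_diag h $ i $ j) ^ e (i, j)) = exp (real (e (i, i)) * h i)" for i
      by (subst prod.remove[of _ i]) (auto simp: exp_diag_def exp_of_nat_mult intro!: prod.neutral)
    then show ?thesis using True by (simp add: exp_sum)
  next
    case False
    then obtain i j where "i \<noteq> j" "e (i, j) \<noteq> 0" by auto
    then have "(\<Prod>j\<in>UNIV. (exp_diag h $ i $ j) ^ e (i, j)) = 0"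
      by (intro prod_zero) (auto simp: exp_diag_def intro!: bexI[of _ j])
    then have "(\<Prod>i\<in>UNIV. \<Prod>j\<in>UNIV. (exp_diag h $ i $ j) ^ e (i, j)) = 0"
      by (intro prod_zero) auto
    then show ?thesis by (simp only: if_not_P[OF False])
  qed
  finally show ?thesis .
qed

lemma rat_rep_entries:
  fixes \<rho> :: "real^'n::finite^'n \<Rightarrow> real^'m^'m"
  assumes "rat_rep \<rho>"
  obtains S c where "\<And>a b. finite (S a b)"
    "\<And>a b g. \<rho> g $ a $ b = (\<Sum>e\<in>S a b. of_rat (c a b e) * (\<Prod>p\<in>UNIV. (g $ fst p $ snd p) ^ e p))"
proof -
  have "\<exists>Sc. finite (fst Sc) \<and> (\<forall>g. \<rho> g $ fst ab $ snd ab =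
      (\<Sum>e\<in>fst Sc. of_rat (snd Sc e) * (\<Prod>p\<in>UNIV. (g $ fst p $ snd p) ^ e p)))" for ab
    using assms by (simp add: rat_rep_def rat_poly_fun_def split_paired_Ex)
  then obtain F where F: "\<And>ab. finite (fst (F ab))" "\<And>ab g. \<rho> g $ fst ab $ snd ab =
      (\<Sum>e\<in>fst (F ab). of_rat (snd (F ab) e) * (\<Prod>p\<in>UNIV. (g $ fst p $ snd p) ^ e p))"
    using choice[of "\<lambda>ab Sc. finite (fst Sc) \<and> (\<forall>g. \<rho> g $ fst ab $ snd ab =
      (\<Sum>e\<in>fst Sc. of_rat (snd Sc e) * (\<Prod>p\<in>UNIV. (g $ fst p $ snd p) ^ e p)))"] by blast
  show thesis
  proof (rule that[of "\<lambda>a b. fst (F (a, b))" "\<lambda>a b. snd (F (a, b))"])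
    show "finite (fst (F (a, b)))" for a b by (rule F(1))
    show "\<rho> g $ a $ b = (\<Sum>e\<in>fst (F (a, b)). of_rat (snd (F (a, b)) e) * (\<Prod>p\<in>UNIV. (g $ fst p $ snd p) ^ e p))"
      for a b g using F(2)[where ab = "(a, b)"] by simp
  qed
qed

text \<open>The restriction of \<open>\<rho>\<close> to the diagonal torus is a finite combination of characters,
  because each monomial in the entries of a diagonal matrix is a character or vanishes.\<close>
lemma rat_rep_exp_diag_expansion:
  fixes \<rho> :: "real^'n::finite^'n \<Rightarrow> real^'m^'m"
  assumes "rat_rep \<rho>"
  obtains E P where "finite E" "E \<subseteq> range torus_char"
    "\<And>h. sum h UNIV = 0 \<Longrightarrow> \<rho> (exp_diag h) = (\<Sum>L\<in>E. exp (L h) *\<^sub>R P L)"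
proof -
  obtain S c where S: "\<And>a b. finite (S a b)"
    and coeff: "\<And>a b g. \<rho> g $ a $ b = (\<Sum>e\<in>S a b. of_rat (c a b e) * (\<Prod>p\<in>UNIV. (g $ fst p $ snd p) ^ e p))"
    using rat_rep_entries[OF assms] by blast
  define diag where "diag e \<longleftrightarrow> (\<forall>i j. i \<noteq> j \<longrightarrow> e (i, j) = (0::nat))" for e :: "'n \<times> 'n \<Rightarrow> nat"
  define char where "char e = torus_char (\<lambda>i. real (e (i, i)))" for e :: "'n \<times> 'n \<Rightarrow> nat"
  define E where "E = (\<Union>a b. char ` S a b)"
  define P where "P L = (\<chi> a b. \<Sum>e\<in>{e\<in>S a b. diag e \<and> char e = L}. (of_rat (c a b e) :: real))" for L
  have "finite E" using S by (simp add: E_def)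
  moreover have "E \<subseteq> range torus_char" by (auto simp: E_def char_def)
  moreover have "\<rho> (exp_diag h) = (\<Sum>L\<in>E. exp (L h) *\<^sub>R P L)" if h: "sum h UNIV = 0" for h
  proof -
    have "\<rho> (exp_diag h) $ a $ b = (\<Sum>L\<in>E. exp (L h) * P L $ a $ b)" for a b
    proof -
      let ?f = "\<lambda>e. of_rat (c a b e) * exp (char e h)"
      have "\<rho> (exp_diag h) $ a $ b = (\<Sum>e\<in>S a b. if diag e then ?f e else 0)"
        unfolding coeff prod_exp_diag_power using h
        by (intro sum.cong) (auto simp: diag_def char_def torus_char_def)
      also have "\<dots> = (\<Sum>e\<in>{e\<in>S a b. diag e}. ?f e)"
        using S by (simp add: sum.inter_filter)
      also have "\<dots> = (\<Sum>L\<in>E. \<Sum>e\<in>{e\<in>{e\<in>S a b. diag e}. char e = L}. ?f e)"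
        using S by (intro sum.group[symmetric]) (auto simp: E_def)
      also have "\<dots> = (\<Sum>L\<in>E. exp (L h) * P L $ a $ b)"
        by (intro sum.cong refl) (auto simp: P_def sum_distrib_left mult.commute intro!: sum.cong)
      finally show ?thesis .
    qed
    then show ?thesis by (simp add: vec_eq_iff sum_component)
  qed
  ultimately show thesis using that by blast
qed

text \<open>Compare the coefficients of the characters in
  \<open>\<rho> (exp_diag h) ** \<rho> (exp_diag k) = \<rho> (exp_diag (h + k))\<close>, which are linearly independent.\<close>
lemma torus_weight_projections:
  fixes \<rho> :: "real^'n::finite^'n \<Rightarrow> real^'m^'m"
  assumes rr: "rat_rep \<rho>" and E: "finite E" "E \<subseteq> range torus_char"
    and expansion: "\<And>h. sum h UNIV = 0 \<Longrightarrow> \<rho> (exp_diag h) = (\<Sum>L\<in>E. exp (L h) *\<^sub>R P L)"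
  shows "\<And>L k. L \<in> E \<Longrightarrow> sum k UNIV = 0 \<Longrightarrow> P L ** \<rho> (exp_diag k) = exp (L k) *\<^sub>R P L"
    and "(\<Sum>L\<in>E. P L) = mat 1"
proof -
  fix L and k :: "'n \<Rightarrow> real"
  assume L: "L \<in> E" and k: "sum k UNIV = 0"
  have "(\<Sum>L\<in>E. exp (L h) *\<^sub>R (P L ** \<rho> (exp_diag k) - exp (L k) *\<^sub>R P L)) = 0"
    if h: "sum h UNIV = 0" for h
  proof -
    have hk: "sum (\<lambda>i. h i + k i) UNIV = 0" using h k by (simp add: sum.distrib)
    have "(\<Sum>L\<in>E. exp (L h) *\<^sub>R (P L ** \<rho> (exp_diag k))) = \<rho> (exp_diag h) ** \<rho> (exp_diag k)"
      by (simp add: expansion[OF h] matrix_mult_sum_left scalar_matrix_assoc)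
    also have "\<dots> = \<rho> (exp_diag (\<lambda>i. h i + k i))"
      using h k by (simp add: exp_diag_add rat_rep_mult[OF rr] exp_diag_in_SL)
    also have "\<dots> = (\<Sum>L\<in>E. exp (L h) *\<^sub>R (exp (L k) *\<^sub>R P L))"
      using E(2) h k by (auto simp: expansion[OF hk] torus_char_add exp_add intro!: sum.cong)
    finally show ?thesis by (simp add: scaleR_diff_right sum_subtractf)
  qed
  then have "P L ** \<rho> (exp_diag k) - exp (L k) *\<^sub>R P L = 0"
    by (rule torus_chars_exp_independent[OF E _ L])
  then show "P L ** \<rho> (exp_diag k) = exp (L k) *\<^sub>R P L" by simp
next
  have "mat 1 = \<rho> (exp_diag (\<lambda>i. 0))"
    using rr by (simp add: exp_diag_zero rat_rep_def)
  also have "\<dots> = (\<Sum>L\<in>E. P L)"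
    using E(2) by (auto simp: expansion torus_char_zero intro!: sum.cong)
  finally show "(\<Sum>L\<in>E. P L) = mat 1" ..
qed

section \<open>The lower bound\<close>

lemma is_norm_continuous:
  fixes N :: "real^'m \<Rightarrow> real"
  assumes "is_norm N"
  shows "continuous_on UNIV N"
proof -
  have triangle: "N (x + y) \<le> N x + N y" and homog: "N (c *\<^sub>R x) = \<bar>c\<bar> * N x" for x y c
    using assms by (auto simp: is_norm_def)
  have "convex_on UNIV N"
  proof (rule convex_onI)
    fix x y :: "real^'m" and t :: real assume "0 < t" "t < 1"
    then show "N ((1 - t) *\<^sub>R x + t *\<^sub>R y) \<le> (1 - t) * N x + t * N y"
      using triangle[of "(1 - t) *\<^sub>R x" "t *\<^sub>R y"] homog[of "1 - t" x] homog[of t y] by simp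
  qed simp
  then show ?thesis by (rule convex_on_continuous[rotated]) simp
qed

lemma is_norm_zero:
  assumes "is_norm N"
  shows "N 0 = 0"
proof -
  have "N ((0::real) *\<^sub>R 0) = \<bar>0::real\<bar> * N 0" using assms unfolding is_norm_def by blast
  then show ?thesis by simp
qed

lemma is_norm_nonneg:
  assumes "is_norm N"
  shows "0 \<le> N x"
proof -
  have "N (x + - x) \<le> N x + N (- x)" "N ((- 1) *\<^sub>R x) = \<bar>- 1\<bar> * N x"
    using assms unfolding is_norm_def by blast+
  then show ?thesis using is_norm_zero[OF assms] by simp
qed

lemma is_norm_sgn:
  assumes "is_norm N"
  shows "N x = norm x * N (sgn x)"
proof (cases "x = 0")
  case True
  then show ?thesis using is_norm_zero[OF assms] by simp
next
  case False
  then show ?thesis using assms by (simp add: is_norm_def sgn_div_norm)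
qed

lemma is_norm_bounds:
  fixes N :: "real^'m \<Rightarrow> real"
  assumes N: "is_norm N"
  obtains b B where "0 < b" "0 < B" "\<And>x. b * norm x \<le> N x" "\<And>x. N x \<le> B * norm x"
proof -
  have cont: "continuous_on (sphere 0 1) N"
    using is_norm_continuous[OF N] continuous_on_subset by blast
  have ne: "sphere (0::real^'m) 1 \<noteq> {}"
    using norm_axis_1[of undefined] by (metis mem_sphere_0 empty_iff)
  obtain x0 where x0: "x0 \<in> sphere 0 1" "\<And>y. y \<in> sphere 0 1 \<Longrightarrow> N x0 \<le> N y"
    using continuous_attains_inf[OF compact_sphere ne cont] by blast
  obtain x1 where x1: "\<And>y. y \<in> sphere 0 1 \<Longrightarrow> N y \<le> N x1"
    using continuous_attains_sup[OF compact_sphere ne cont] by blast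
  have "x0 \<noteq> 0" using x0(1) by auto
  with N have "N x0 \<noteq> 0" by (auto simp: is_norm_def)
  then have b: "0 < N x0" using is_norm_nonneg[OF N, of x0] by simp
  show thesis
  proof (rule that[of "N x0" "N x1"])
    show "0 < N x0" "0 < N x1" using b x1[OF x0(1)] by simp_all
    show "N x0 * norm x \<le> N x" for x
    proof (cases "x = 0")
      case False
      then have "N x0 \<le> N (sgn x)" using x0(2) by (simp add: norm_sgn)
      from mult_left_mono[OF this norm_ge_zero] show ?thesis using is_norm_sgn[OF N, of x] by (simp add: mult.commute)
    qed (simp add: is_norm_zero[OF N])
    show "N x \<le> N x1 * norm x" for x
    proof (cases "x = 0")
      case False
      then have "N (sgn x) \<le> N x1" using x1 by (simp add: norm_sgn)
      from mult_left_mono[OF this norm_ge_zero] show ?thesis using is_norm_sgn[OF N, of x] by (simp add: mult.commute)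
    qed (simp add: is_norm_zero[OF N])
  qed
qed

text \<open>Choose a block permutation \<open>\<sigma>\<close> with \<open>L (h \<circ> \<sigma>) \<ge> 0\<close>: then \<open>exp (L (h \<circ> \<sigma>)) \<ge> 1\<close>,
  and on \<open>K\<close>-fixed vectors \<open>\<rho> (exp_diag (h \<circ> \<sigma>))\<close> differs from \<open>\<rho> (exp_diag h)\<close>
  by the matrix \<open>M \<sigma>\<close>.\<close>
lemma weight_component_le:
  fixes Is :: "'n::{finite,linorder} set list" and \<rho> :: "((real,'n) vec,'n) vec \<Rightarrow> real^'m^'m"
  assumes cp: "consec_partition Is" and L: "L \<in> range torus_char"
    and equivariant: "\<And>k. sum k UNIV = 0 \<Longrightarrow> A ** \<rho> (exp_diag k) = exp (L k) *\<^sub>R A"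
    and realized: "\<And>\<sigma>. \<sigma> \<in> block_perms Is \<Longrightarrow> perm_realized_by \<rho> Is \<sigma> (M \<sigma>)"
    and v: "v \<in> fixed_vecs \<rho> (KU_grp Is)" and hb: "\<forall>t<length Is. sum h (Is ! t) = 0"
  shows "norm (A *v v)
    \<le> (\<Sum>\<sigma>\<in>block_perms Is. onorm ((*v) A) * onorm ((*v) (M \<sigma>))) * norm (\<rho> (exp_diag h) *v v)"
proof -
  let ?y = "\<rho> (exp_diag h) *v v"
  note onorm = onorm[OF matrix_vector_mul_bounded_linear] onorm_pos_le[OF matrix_vector_mul_bounded_linear]
  from L obtain w where w: "L = torus_char w" by (elim rangeE)
  obtain \<sigma> where \<sigma>: "\<sigma> \<in> block_perms Is" "0 \<le> (\<Sum>i\<in>UNIV. w i * h (\<sigma> i))"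
    using exists_block_perm_pairing_nonneg[OF cp hb] by blast
  have h: "sum h UNIV = 0" using hb by (simp add: consec_partition_sum[OF cp])
  then have h\<sigma>: "sum (h \<circ> \<sigma>) UNIV = 0"
    using \<sigma>(1) sum.permute[of \<sigma> UNIV h] by (simp add: block_perms_def)
  have "norm (A *v v) \<le> exp (L (h \<circ> \<sigma>)) * norm (A *v v)"
    using \<sigma>(2) h\<sigma> by (simp add: w torus_char_def mult_le_cancel_right1)
  also have "\<dots> = norm (A *v (\<rho> (exp_diag (h \<circ> \<sigma>)) *v v))"
    by (simp add: matrix_vector_mul_assoc equivariant[OF h\<sigma>] scaleR_matrix_vector_assoc[symmetric])
  also have "\<dots> = norm (A *v (M \<sigma> *v ?y))"
    using realized[OF \<sigma>(1)] h v by (simp add: perm_realized_by_def)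
  also have "\<dots> \<le> onorm ((*v) A) * (onorm ((*v) (M \<sigma>)) * norm ?y)"
    using onorm(1)[of A "M \<sigma> *v ?y"] mult_left_mono[OF onorm(1)[of "M \<sigma>" ?y] onorm(2)[of A]]
    by linarith
  also have "\<dots> \<le> (\<Sum>\<sigma>\<in>block_perms Is. onorm ((*v) A) * onorm ((*v) (M \<sigma>))) * norm ?y"
  proof -
    have "onorm ((*v) A) * onorm ((*v) (M \<sigma>)) \<le> (\<Sum>\<sigma>\<in>block_perms Is. onorm ((*v) A) * onorm ((*v) (M \<sigma>)))"
      using \<sigma>(1) by (intro member_le_sum[OF _ _ finite_block_perms])
        (auto intro!: mult_nonneg_nonneg onorm_pos_le matrix_vector_mul_bounded_linear)
    from mult_right_mono[OF this norm_ge_zero] show ?thesis by (simp add: mult.assoc)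
  qed
  finally show ?thesis .
qed

lemma fixed_vecs_exp_diag_lower_bound:
  fixes Is :: "'n::{finite,linorder} set list" and \<rho> :: "((real,'n) vec,'n) vec \<Rightarrow> real^'m^'m"
  assumes rr: "rat_rep \<rho>" and cp: "consec_partition Is"
  obtains Q where "0 < Q"
    "\<And>v (h :: 'n \<Rightarrow> real). v \<in> fixed_vecs \<rho> (KU_grp Is) \<Longrightarrow> \<forall>t<length Is. sum h (Is ! t) = 0 \<Longrightarrow>
       norm v \<le> Q * norm (\<rho> (exp_diag h) *v v)"
proof -
  obtain E :: "(('n \<Rightarrow> real) \<Rightarrow> real) set" and P where E: "finite E" "E \<subseteq> range torus_char"
    and expansion: "\<And>h. sum h UNIV = 0 \<Longrightarrow> \<rho> (exp_diag h) = (\<Sum>L\<in>E. exp (L h) *\<^sub>R P L)"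
    using rat_rep_exp_diag_expansion[OF rr] by blast
  have proj: "\<And>L k. L \<in> E \<Longrightarrow> sum k UNIV = 0 \<Longrightarrow> P L ** \<rho> (exp_diag k) = exp (L k) *\<^sub>R P L"
    "(\<Sum>L\<in>E. P L) = mat 1"
    using torus_weight_projections[OF rr E] expansion by blast+
  have "\<forall>\<sigma>\<in>block_perms Is. \<exists>M. perm_realized_by \<rho> Is \<sigma> M"
    using block_perms_realized[OF rr cp] by blast
  from bchoice[OF this] obtain M where M: "\<forall>\<sigma>\<in>block_perms Is. perm_realized_by \<rho> Is \<sigma> (M \<sigma>)"
    by (elim exE)
  define K where "K L = (\<Sum>\<sigma>\<in>block_perms Is. onorm ((*v) (P L)) * onorm ((*v) (M \<sigma>)))" for L
  have "0 \<le> K L" for L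
    unfolding K_def by (intro sum_nonneg mult_nonneg_nonneg onorm_pos_le matrix_vector_mul_bounded_linear)
  then have "0 < (\<Sum>L\<in>E. K L) + 1" by (simp add: sum_nonneg add_nonneg_pos)
  moreover have "norm v \<le> ((\<Sum>L\<in>E. K L) + 1) * norm (\<rho> (exp_diag h) *v v)"
    if v: "v \<in> fixed_vecs \<rho> (KU_grp Is)" and hb: "\<forall>t<length Is. sum h (Is ! t) = 0" for v h
  proof -
    have "(\<Sum>L\<in>E. P L *v v) = v"
      using proj(2) by (simp add: matrix_vector_mult_sum_left[symmetric])
    then have "norm v \<le> (\<Sum>L\<in>E. norm (P L *v v))"
      using norm_sum[of "\<lambda>L. P L *v v" E] by simp
    also have "\<dots> \<le> (\<Sum>L\<in>E. K L * norm (\<rho> (exp_diag h) *v v))"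
    proof (rule sum_mono)
      fix L assume L: "L \<in> E"
      show "norm (P L *v v) \<le> K L * norm (\<rho> (exp_diag h) *v v)"
        unfolding K_def
        by (rule weight_component_le[OF cp subsetD[OF E(2) L]]) (simp_all add: proj(1)[OF L] M v hb)
    qed
    also have "\<dots> \<le> ((\<Sum>L\<in>E. K L) + 1) * norm (\<rho> (exp_diag h) *v v)"
      by (simp add: sum_distrib_right[symmetric] distrib_right)
    finally show ?thesis .
  qed
  ultimately show thesis using that by blast
qed

lemma A_plus_exp_diag:
  assumes "d \<in> A_plus Is"
  obtains h where "d = exp_diag h" "\<forall>t<length Is. sum h (Is ! t) = 0"
proof -
  obtain x where x: "d = (\<chi> i j. if i = j then x i else 0)" "\<And>i. 0 < x i"
    "\<forall>t<length Is. (\<Prod>i\<in>Is ! t. x i) = 1"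
    using assms unfolding A_plus_def by blast
  show thesis
  proof (rule that[of "\<lambda>i. ln (x i)"])
    show "d = exp_diag (\<lambda>i. ln (x i))" using x(1,2) by (simp add: exp_diag_def vec_eq_iff)
    show "\<forall>t<length Is. (\<Sum>i\<in>Is ! t. ln (x i)) = 0"
      using x(2,3) by (simp add: ln_prod[symmetric] less_imp_neq[OF x(2), symmetric])
  qed
qed

theorem lemma3p5:
  fixes Is :: "('n::{finite,linorder}) set list"
    and \<rho> :: "((real,'n) vec,'n) vec \<Rightarrow> real^'m^'m"
    and N :: "real^'m \<Rightarrow> real"
  assumes "CARD('n) \<ge> 2"
    and "consec_partition Is"
    and "rat_rep \<rho>" and "irreducible_rep \<rho>" and "nontrivial_rep \<rho>"
    and "is_norm N"
  shows "\<exists>C2>0. \<forall>v\<in>fixed_vecs \<rho> (KU_grp Is). \<forall>d\<in>A_plus Is. N (\<rho> d *v v) \<ge> C2 * N v"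
proof -
  obtain Q where Q: "0 < Q" and bound: "\<And>v h. v \<in> fixed_vecs \<rho> (KU_grp Is) \<Longrightarrow>
      \<forall>t<length Is. sum h (Is ! t) = 0 \<Longrightarrow> norm v \<le> Q * norm (\<rho> (exp_diag h) *v v)"
    using fixed_vecs_exp_diag_lower_bound[OF assms(3,2)] by blast
  obtain b B where b: "0 < b" "0 < B" "\<And>x. b * norm x \<le> N x" "\<And>x. N x \<le> B * norm x"
    using is_norm_bounds[OF assms(6)] by blast
  have "b / (Q * B) * N v \<le> N (\<rho> d *v v)"
    if v: "v \<in> fixed_vecs \<rho> (KU_grp Is)" and d: "d \<in> A_plus Is" for v d
  proof -
    obtain h where "d = exp_diag h" "\<forall>t<length Is. sum h (Is ! t) = 0"
      using A_plus_exp_diag[OF d] by blast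
    then have "norm v \<le> Q * norm (\<rho> d *v v)" using bound[OF v] by simp
    have "b / (Q * B) * N v \<le> b / (Q * B) * (B * norm v)"
      using b Q by (intro mult_left_mono) auto
    also have "\<dots> = b / Q * norm v" using b(2) by simp
    also have "\<dots> \<le> b / Q * (Q * norm (\<rho> d *v v))"
      using b(1) Q \<open>norm v \<le> Q * norm (\<rho> d *v v)\<close> by (intro mult_left_mono) auto
    also have "\<dots> = b * norm (\<rho> d *v v)" using Q by simp
    also have "\<dots> \<le> N (\<rho> d *v v)" by (rule b(3))
    finally show ?thesis .
  qed
  then show ?thesis using Q b by (intro exI[of _ "b / (Q * B)"]) auto
qed

end
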